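(* For every pair of odd integers $p,q\geq 3$ there exists an admissible pair of cyclic steps $(a,b)$ such that the dual-grid configuration $Z_{p,q}(a,b)=A\sqcup B$ consists of $2pq$ rays and supports $pq$ orthogonal contexts (the sets $C_{ij}$, $(i,j)\in\mathbb Z_p\times\mathbb Z_q$), such that every ray of $Z_{p,q}(a,b)$ occurs in exactly two of these contexts. In particular, $Z_{p,q}(a,b)$ is a Kochen--Specker configuration admitting a parity proof.
   Context: Let $V=\mathbb R^4=\mathbb R^2\oplus\mathbb R^2$ with the standard Euclidean inner product. A ray is a point of $\mathbb P(V)=\mathbb P^3(\mathbb R)$; two rays $[v],[w]$ are orthogonal if $\langle v,w\rangle=0$. An orthogonal context is a set of four pairwise orthogonal rays. Kochen--Specker configurations: a finite set $Z$ of rays, together with a family $\mathcal C$ of orthogonal contexts contained in $Z$, is a Kochen--Specker configuration if there is no function $v\colon Z\to\{0,1\}$ such that every context in $\mathcal C$ contains exactly one ray with value $1$. A parity proof is a family $\mathcal C$ of contexts contained in $Z$ with $|\mathcal C|$ odd and every ray of $Z$ occurring in an even number of members of $\mathcal C$. Dual-grid configurations: let $p,q\ge3$ be odd, $\mathbb Z_m=\mathbb Z/m\mathbb Z$, $a\in\mathbb Z_p^\times$, $b\in\mathbb Z_q^\times$, $\alpha=2\pi a/p$, $\beta=2\pi b/q$, $u(\theta)=(\cos\theta,\sin\theta)$. The pair $(a,b)$ is admissible if $-\cos(\alpha-\beta)/\cos(\alpha+\beta)$ is positive and finite and different from $1$. For an admissible pair let $c>0$ be defined by $c^2=-\cos(\alpha-\beta)/\cos(\alpha+\beta)$,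 and for $(i,j)\in\mathbb Z_p\times\mathbb Z_q$ put $$A_{ij}=[\,u(i\alpha-j\beta),\,-c\,u(i\alpha+j\beta)\,],\qquad B_{ij}=[\,c\,u(i\alpha-j\beta),\,u(i\alpha+j\beta)\,],$$ $A=\{A_{ij}\}$, $B=\{B_{ij}\}$, $Z_{p,q}(a,b)=A\sqcup B$, and $$C_{ij}=\{A_{ij},\,A_{i-1,j-1},\,B_{i,j-1},\,B_{i-1,j}\}.$$ *)

theory Defs
  imports "HOL-Analysis.Analysis" "HOL-Number_Theory.Cong"
begin

section \<open>Rays, contexts and Kochen--Specker configurations\<close>

type_synonym V = "(real^2) \<times> (real^2)"

text \<open>A point \<open>[v]\<close> of the projective space of \<open>V\<close> is the line spanned by a nonzero vector \<open>v\<close>.\<close>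

definition ray :: "V \<Rightarrow> V set" where
  "ray v = span {v}"

definition rays :: "V set set" where
  "rays = {ray v | v. v \<noteq> 0}"

definition orthogonal_rays :: "V set \<Rightarrow> V set \<Rightarrow> bool" where
  "orthogonal_rays L M \<longleftrightarrow> (\<forall>v\<in>L. \<forall>w\<in>M. v \<bullet> w = 0)"

lemma orthogonal_rays_ray [simp]: "orthogonal_rays (ray v) (ray w) \<longleftrightarrow> v \<bullet> w = 0"
  unfolding orthogonal_rays_def ray_def span_singleton by force

definition orthogonal_context :: "V set set \<Rightarrow> bool" where
  "orthogonal_context C \<longleftrightarrow> C \<subseteq> rays \<and> card C = 4 \<and> pairwise orthogonal_rays C"

definition kochen_specker :: "V set set \<Rightarrow> V set set set \<Rightarrow> bool" where
  "kochen_specker Z \<C> \<longleftrightarrow>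
     finite Z \<and> Z \<subseteq> rays \<and> (\<forall>C\<in>\<C>. orthogonal_context C \<and> C \<subseteq> Z) \<and>
     \<not> (\<exists>v :: V set \<Rightarrow> nat. v \<in> Z \<rightarrow> {0, 1} \<and> (\<forall>C\<in>\<C>. \<exists>!r. r \<in> C \<and> v r = 1))"

definition parity_proof :: "V set set \<Rightarrow> V set set set \<Rightarrow> bool" where
  "parity_proof Z \<C> \<longleftrightarrow>
     (\<forall>C\<in>\<C>. orthogonal_context C \<and> C \<subseteq> Z) \<and> odd (card \<C>) \<and>
     (\<forall>r\<in>Z. even (card {C \<in> \<C>. r \<in> C}))"

section \<open>Dual-grid configurations\<close>

text \<open>
  Residue classes modulo \<open>p\<close> and \<open>q\<close> are given by integer representatives; a unit is a
  representative coprime to the modulus. The lemmas \<open>rayA_cong\<close> and \<open>rayB_cong\<close> below show that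
  the rays only depend on the classes of the indices and of the steps, so that the integer indices
  \<open>i - 1\<close>, \<open>j - 1\<close> in \<open>grid_context\<close> are to be read cyclically.
\<close>

definition unit_vec :: "real \<Rightarrow> real^2" where
  "unit_vec \<theta> = vector [cos \<theta>, sin \<theta>]"

definition step_angle :: "nat \<Rightarrow> int \<Rightarrow> real" where
  "step_angle m a = 2 * pi * of_int a / of_nat m"

definition dual_c_squared :: "nat \<Rightarrow> nat \<Rightarrow> int \<Rightarrow> int \<Rightarrow> real" where
  "dual_c_squared p q a b =
     - cos (step_angle p a - step_angle q b) / cos (step_angle p a + step_angle q b)"

text \<open>The condition \<open>cos (\<alpha> + \<beta>) \<noteq> 0\<close> says that the quotient is finite.\<close>

definition admissible :: "nat \<Rightarrow> nat \<Rightarrow> int \<Rightarrow> int \<Rightarrow> bool" where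
  "admissible p q a b \<longleftrightarrow>
     coprime a (int p) \<and> coprime b (int q) \<and>
     cos (step_angle p a + step_angle q b) \<noteq> 0 \<and>
     dual_c_squared p q a b > 0 \<and> dual_c_squared p q a b \<noteq> 1"

definition dual_c :: "nat \<Rightarrow> nat \<Rightarrow> int \<Rightarrow> int \<Rightarrow> real" where
  "dual_c p q a b = sqrt (dual_c_squared p q a b)"

definition rayA :: "nat \<Rightarrow> nat \<Rightarrow> int \<Rightarrow> int \<Rightarrow> int \<Rightarrow> int \<Rightarrow> V set" where
  "rayA p q a b i j =
     ray (unit_vec (of_int i * step_angle p a - of_int j * step_angle q b),
          - dual_c p q a b *\<^sub>R unit_vec (of_int i * step_angle p a + of_int j * step_angle q b))"

definition rayB :: "nat \<Rightarrow> nat \<Rightarrow> int \<Rightarrow> int \<Rightarrow> int \<Rightarrow> int \<Rightarrow> V set" where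
  "rayB p q a b i j =
     ray (dual_c p q a b *\<^sub>R unit_vec (of_int i * step_angle p a - of_int j * step_angle q b),
          unit_vec (of_int i * step_angle p a + of_int j * step_angle q b))"

definition grid_indices :: "nat \<Rightarrow> nat \<Rightarrow> (int \<times> int) set" where
  "grid_indices p q = {0..<int p} \<times> {0..<int q}"

definition setA :: "nat \<Rightarrow> nat \<Rightarrow> int \<Rightarrow> int \<Rightarrow> V set set" where
  "setA p q a b = {rayA p q a b i j | i j. (i, j) \<in> grid_indices p q}"

definition setB :: "nat \<Rightarrow> nat \<Rightarrow> int \<Rightarrow> int \<Rightarrow> V set set" where
  "setB p q a b = {rayB p q a b i j | i j. (i, j) \<in> grid_indices p q}"

definition dual_grid :: "nat \<Rightarrow> nat \<Rightarrow> int \<Rightarrow> int \<Rightarrow> V set set" where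
  "dual_grid p q a b = setA p q a b \<union> setB p q a b"

definition grid_context :: "nat \<Rightarrow> nat \<Rightarrow> int \<Rightarrow> int \<Rightarrow> int \<Rightarrow> int \<Rightarrow> V set set" where
  "grid_context p q a b i j =
     {rayA p q a b i j, rayA p q a b (i - 1) (j - 1), rayB p q a b i (j - 1), rayB p q a b (i - 1) j}"

definition grid_contexts :: "nat \<Rightarrow> nat \<Rightarrow> int \<Rightarrow> int \<Rightarrow> V set set set" where
  "grid_contexts p q a b = {grid_context p q a b i j | i j. (i, j) \<in> grid_indices p q}"

lemma unit_vec_periodic: "unit_vec (\<theta> + 2 * pi * of_int n) = unit_vec \<theta>"
  by (simp add: unit_vec_def cos_add sin_add)

lemma step_angle_cong:
  assumes "m > 0" "[i = i'] (mod int m)" "[a = a'] (mod int m)"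
  obtains n :: int where "of_int i * step_angle m a = of_int i' * step_angle m a' + 2 * pi * of_int n"
proof -
  have "[i * a = i' * a'] (mod int m)" using assms(2,3) by (rule cong_mult)
  then obtain n where "i * a = i' * a' + int m * n"
    by (metis cong_iff_lin cong_sym)
  then have "(of_int i * of_int a :: real) = of_int i' * of_int a' + of_nat m * of_int n"
    by (metis of_int_add of_int_mult of_int_of_nat_eq)
  moreover have "of_int i * step_angle m a = 2 * pi * (of_int i * of_int a) / of_nat m"
    and "of_int i' * step_angle m a' = 2 * pi * (of_int i' * of_int a') / of_nat m"
    by (simp_all add: step_angle_def)
  ultimately have "of_int i * step_angle m a = of_int i' * step_angle m a' + 2 * pi * of_int n"
    using assms(1) by (simp add: distrib_left add_divide_distrib)
  then show thesis by (rule that)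
qed

lemma unit_vec_cong:
  assumes "p > 0" "q > 0" "[i = i'] (mod int p)" "[j = j'] (mod int q)"
    and "[a = a'] (mod int p)" "[b = b'] (mod int q)"
  shows "unit_vec (of_int i * step_angle p a - of_int j * step_angle q b) =
         unit_vec (of_int i' * step_angle p a' - of_int j' * step_angle q b')" (is ?minus)
    and "unit_vec (of_int i * step_angle p a + of_int j * step_angle q b) =
         unit_vec (of_int i' * step_angle p a' + of_int j' * step_angle q b')" (is ?plus)
proof -
  obtain m n :: int where
    m: "of_int i * step_angle p a = of_int i' * step_angle p a' + 2 * pi * of_int m" and
    n: "of_int j * step_angle q b = of_int j' * step_angle q b' + 2 * pi * of_int n"
    using step_angle_cong assms by meson
  show ?minus
    using unit_vec_periodic[of "of_int i' * step_angle p a' - of_int j' * step_angle q b'" "m - n"]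
    by (simp add: m n algebra_simps)
  show ?plus
    using unit_vec_periodic[of "of_int i' * step_angle p a' + of_int j' * step_angle q b'" "m + n"]
    by (simp add: m n algebra_simps)
qed

lemma dual_c_cong:
  assumes "p > 0" "q > 0" "[a = a'] (mod int p)" "[b = b'] (mod int q)"
  shows "dual_c p q a b = dual_c p q a' b'"
proof -
  have "cos (step_angle p a - step_angle q b) = cos (step_angle p a' - step_angle q b')"
    and "cos (step_angle p a + step_angle q b) = cos (step_angle p a' + step_angle q b')"
    using unit_vec_cong[OF assms(1,2) cong_refl[of 1] cong_refl[of 1] assms(3,4)]
    by (auto simp: unit_vec_def vec_eq_iff forall_2)
  then show ?thesis by (simp add: dual_c_def dual_c_squared_def)
qed

lemma rayA_cong:
  assumes "p > 0" "q > 0" "[i = i'] (mod int p)" "[j = j'] (mod int q)"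
    and "[a = a'] (mod int p)" "[b = b'] (mod int q)"
  shows "rayA p q a b i j = rayA p q a' b' i' j'"
  unfolding rayA_def unit_vec_cong[OF assms] dual_c_cong[OF assms(1,2,5,6)] ..

lemma rayB_cong:
  assumes "p > 0" "q > 0" "[i = i'] (mod int p)" "[j = j'] (mod int q)"
    and "[a = a'] (mod int p)" "[b = b'] (mod int q)"
  shows "rayB p q a b i j = rayB p q a' b' i' j'"
  unfolding rayB_def unit_vec_cong[OF assms] dual_c_cong[OF assms(1,2,5,6)] ..

end

theory Submission imports Defs begin

text \<open>
  The inner product of \<open>A\<^sub>i\<^sub>j\<close> and \<open>B\<^sub>k\<^sub>l\<close> is \<open>2 c sin ((i - k) \<alpha>) sin ((j - l) \<beta>)\<close>, and the choice of \<open>c\<close>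
  makes the two rays of the same kind in a context orthogonal. As \<open>p\<close> and \<open>q\<close> are odd, equality of
  rays of the same kind forces congruent indices, while \<open>c \<noteq> 1\<close> separates the two kinds; the
  incidences between rays and contexts are therefore those of the torus \<open>\<int>\<^sub>p \<times> \<int>\<^sub>q\<close>, and double
  counting of incidences excludes a colouring. Since \<open>2 cos (\<alpha> - \<beta>) cos (\<alpha> + \<beta>) = cos 2\<alpha> + cos 2\<beta>\<close>,
  a pair is admissible as soon as both summands are negative, which is achieved by taking \<open>2\<alpha>\<close> and
  \<open>2\<beta>\<close> as close to \<open>\<pi>\<close> as possible.
\<close>

section \<open>Unit vectors and equality of rays\<close>

lemma unit_vec_inner: "unit_vec \<theta> \<bullet> unit_vec \<phi> = cos (\<theta> - \<phi>)"
  by (simp add: unit_vec_def inner_vec_def sum_2 cos_diff)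

lemma unit_vec_nonzero: "unit_vec \<theta> \<noteq> 0"
  using unit_vec_inner[of \<theta> \<theta>] by auto

text \<open>Pairing with \<open>unit_vec \<phi>\<close> identifies t as a cosine, and comparing
  lengths makes its square 1, so the sine vanishes.\<close>

lemma unit_vec_scaled:
  assumes "unit_vec \<theta> = t *\<^sub>R unit_vec \<phi>"
  shows "t = cos (\<theta> - \<phi>)" "sin (\<theta> - \<phi>) = 0" "t\<^sup>2 = 1"
proof -
  show t: "t = cos (\<theta> - \<phi>)"
    using arg_cong[OF assms, of "\<lambda>v. v \<bullet> unit_vec \<phi>"] by (simp add: unit_vec_inner)
  show "t\<^sup>2 = 1"
    using arg_cong[OF assms, of "\<lambda>v. v \<bullet> v"] by (simp add: unit_vec_inner power2_eq_square)
  with t show "sin (\<theta> - \<phi>) = 0"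
    using sin_cos_squared_add[of "\<theta> - \<phi>"] by simp
qed

lemma ray_eqD:
  assumes "ray v = ray w"
  obtains t where "v = t *\<^sub>R w"
  using assms span_base[of v "{v}"] unfolding ray_def span_singleton by auto

lemma orthogonal_rays_sym: "orthogonal_rays L M \<longleftrightarrow> orthogonal_rays M L"
  unfolding orthogonal_rays_def by (metis inner_commute)

text \<open>A single factor t relates both components, so it is the cosine of both angle
  differences. The common coefficients r, s cover A with (1, -c) and B with (c, 1).\<close>

lemma ray_pair_eqD:
  assumes "ray (r *\<^sub>R unit_vec \<theta>, s *\<^sub>R unit_vec \<phi>) = ray (r *\<^sub>R unit_vec \<theta>', s *\<^sub>R unit_vec \<phi>')"
    and "r \<noteq> 0" "s \<noteq> 0"
  shows "sin (\<theta> - \<theta>') = 0" "cos (\<theta> - \<theta>') = cos (\<phi> - \<phi>')"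
proof -
  obtain t where t: "r *\<^sub>R unit_vec \<theta> = t *\<^sub>R r *\<^sub>R unit_vec \<theta>'" "s *\<^sub>R unit_vec \<phi> = t *\<^sub>R s *\<^sub>R unit_vec \<phi>'"
    using ray_eqD[OF assms(1)] by auto
  have "unit_vec \<theta> = t *\<^sub>R unit_vec \<theta>'" "unit_vec \<phi> = t *\<^sub>R unit_vec \<phi>'"
    using t assms(2,3) by (metis real_vector.scale_left_commute scaleR_cancel_left)+
  then show "sin (\<theta> - \<theta>') = 0" "cos (\<theta> - \<theta>') = cos (\<phi> - \<phi>')"
    using unit_vec_scaled by metis+
qed

section \<open>Step angles and admissible pairs\<close>

lemma sin_step_angle_eq_0_iff:
  assumes "odd m" "coprime a (int m)"
  shows "sin (of_int k * step_angle m a) = 0 \<longleftrightarrow> int m dvd k"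
proof
  have m: "m > 0" using assms(1) by (cases m) auto
  assume "sin (of_int k * step_angle m a) = 0"
  then obtain n :: int where "of_int k * step_angle m a = of_int n * pi"
    unfolding sin_zero_iff_int2 by blast
  then have "real_of_int (2 * k * a) = of_int (n * int m)"
    using m by (simp add: step_angle_def field_simps)
  then have "2 * k * a = n * int m"
    by linarith
  then have "int m dvd 2 * k * a" by simp
  \<comment> \<open>Oddness of m allows the factor 2 to be cancelled, coprimality the factor
    a.\<close>
  moreover have "coprime (int m) 2" "coprime (int m) a"
    using assms by (simp_all add: coprime_commute)
  ultimately show "int m dvd k"
    by (metis coprime_dvd_mult_left_iff coprime_dvd_mult_right_iff)
next
  assume "int m dvd k"
  then obtain n where "k = int m * n" ..
  moreover have "m > 0" using assms(1) by (cases m) auto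
  ultimately have "of_int k * step_angle m a = of_int (2 * n * a) * pi"
    by (simp add: step_angle_def field_simps)
  then show "sin (of_int k * step_angle m a) = 0"
    unfolding sin_zero_iff_int2 by blast
qed

text \<open>A zero would give 4a = nm with n and m both odd, contradicting parity.\<close>

lemma cos_step_angle_nonzero:
  assumes "odd m"
  shows "cos (step_angle m a) \<noteq> 0"
proof
  have m: "m > 0" using assms by (cases m) auto
  assume "cos (step_angle m a) = 0"
  then obtain n :: int where n: "odd n" "step_angle m a = of_int n * (pi / 2)"
    unfolding cos_zero_iff_int by blast
  then have "real_of_int (4 * a) = of_int (n * int m)"
    using m by (simp add: step_angle_def field_simps)
  then have "4 * a = n * int m"
    by linarith
  moreover have "odd (n * int m)" using n(1) assms by simp
  ultimately show False by (metis even_mult_iff even_numeral)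
qed

text \<open>One of m + 1 and m - 1 is divisible by 4; let 4a be that number. Then twice the step
  angle is \<pi> + \<pi>/m or \<pi> - \<pi>/m, and a common divisor of a and m divides 4a - m, which
  is 1 or -1.\<close>

lemma cos_double_step_angle_negative:
  assumes "odd m" "m \<ge> 3"
  obtains a where "coprime a (int m)" "cos (2 * step_angle m a) < 0"
proof -
  obtain a e :: int where ae: "4 * a = int m + e" "e = 1 \<or> e = -1"
  proof (cases "m mod 4 = 1")
    case True
    then have "4 * (int m div 4) = int m + -1" by presburger
    then show thesis using that by blast
  next
    case False
    then have "4 * ((int m + 1) div 4) = int m + 1" using assms(1) by presburger
    then show thesis using that by blast
  qed
  have "coprime a (int m)"
  proof (rule coprimeI)
    fix d assume "d dvd a" "d dvd int m"
    then have "d dvd 4 * a - int m" by simp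
    then show "is_unit d" using ae by auto
  qed
  moreover have "2 * step_angle m a = pi + of_int e * (pi / m)"
  proof -
    have "4 * real_of_int a = real m + of_int e"
      using arg_cong[OF ae(1), of real_of_int] by simp
    then have "2 * step_angle m a = pi * (real m + of_int e) / m"
      by (simp add: step_angle_def field_simps)
    then show ?thesis using assms(2) by (simp add: field_simps)
  qed
  then have "cos (2 * step_angle m a) = - cos (pi / m)"
    using ae(2) by (auto simp: cos_add)
  moreover have "cos (pi / m) > 0"
    using assms(2) by (intro cos_gt_zero) (auto simp: field_simps)
  ultimately show thesis using that by simp
qed

lemma admissible_exists:
  assumes "odd p" "p \<ge> 3" "odd q" "q \<ge> 3"
  obtains a b where "admissible p q a b"
proof -
  obtain a where a: "coprime a (int p)" "cos (2 * step_angle p a) < 0"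
    using cos_double_step_angle_negative assms by blast
  obtain b where b: "coprime b (int q)" "cos (2 * step_angle q b) < 0"
    using cos_double_step_angle_negative assms by blast
  define \<alpha> \<beta> where "\<alpha> = step_angle p a" and "\<beta> = step_angle q b"
  have "cos (\<alpha> - \<beta>) * cos (\<alpha> + \<beta>) = (cos (2 * \<beta>) + cos (2 * \<alpha>)) / 2"
    unfolding cos_times_cos by (simp add: algebra_simps)
  then have neg: "cos (\<alpha> - \<beta>) * cos (\<alpha> + \<beta>) < 0"
    using a b by (simp add: \<alpha>_def \<beta>_def)
  then have "- cos (\<alpha> - \<beta>) / cos (\<alpha> + \<beta>) > 0" "cos (\<alpha> + \<beta>) \<noteq> 0"
    by (auto simp: mult_less_0_iff divide_simps)
  \<comment> \<open>The value 1 would mean that the two cosines sum to 0; their sum is 2 cos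
    \<alpha> cos \<beta>, which is nonzero since p and q are odd.\<close>
  moreover have "- cos (\<alpha> - \<beta>) / cos (\<alpha> + \<beta>) \<noteq> 1"
  proof
    assume "- cos (\<alpha> - \<beta>) / cos (\<alpha> + \<beta>) = 1"
    then have "- cos (\<alpha> - \<beta>) = cos (\<alpha> + \<beta>)"
      using \<open>cos (\<alpha> + \<beta>) \<noteq> 0\<close> by (simp add: field_simps)
    then have "cos \<alpha> * cos \<beta> = 0" by (simp add: cos_add cos_diff)
    then show False
      using cos_step_angle_nonzero assms by (simp add: \<alpha>_def \<beta>_def)
  qed
  ultimately have "admissible p q a b"
    using a b by (simp add: admissible_def dual_c_squared_def \<alpha>_def \<beta>_def)
  then show thesis using that by blast
qed

section \<open>Parity proofs exclude colourings\<close>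

lemma parity_proof_imp_kochen_specker:
  assumes "finite Z" "Z \<subseteq> rays" and par: "parity_proof Z \<C>"
  shows "kochen_specker Z \<C>"
proof -
  have sub: "\<forall>C\<in>\<C>. orthogonal_context C \<and> C \<subseteq> Z" and odd: "odd (card \<C>)"
    and even: "\<forall>r\<in>Z. even (card {C \<in> \<C>. r \<in> C})"
    using par by (auto simp: parity_proof_def)
  \<comment> \<open>\<open>card\<close> of an infinite set is 0, which is even.\<close>
  have fin: "finite \<C>" using odd by (metis card.infinite even_zero)
  have False if v: "v \<in> Z \<rightarrow> {0, 1}" "\<forall>C\<in>\<C>. \<exists>!r. r \<in> C \<and> v r = 1" for v :: "V set \<Rightarrow> nat"
  proof -
    define Y where "Y = {r \<in> Z. v r = 1}"
    have "card {r \<in> Y. r \<in> C} = 1" if "C \<in> \<C>" for C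
    proof -
      obtain r where "r \<in> C \<and> v r = 1" "\<And>s. s \<in> C \<and> v s = 1 \<Longrightarrow> s = r"
        using bspec[OF v(2) \<open>C \<in> \<C>\<close>] by (elim ex1E) blast
      moreover have "C \<subseteq> Z" using sub \<open>C \<in> \<C>\<close> by blast
      ultimately have "{r \<in> Y. r \<in> C} = {r}"
        unfolding Y_def by blast
      then show ?thesis by simp
    qed
    \<comment> \<open>Incidences between contexts and rays of value 1 are counted twice: one per
      context gives an odd total, while summing over rays gives an even one.\<close>
    then have "card \<C> = (\<Sum>C\<in>\<C>. card {r \<in> Y. r \<in> C})" by simp
    also have "\<dots> = (\<Sum>r\<in>Y. card {C \<in> \<C>. r \<in> C})"
      using fin assms(1) by (intro sum_multicount_gen[symmetric]) (auto simp: Y_def)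
    also have "even \<dots>" using even by (intro dvd_sum) (auto simp: Y_def)
    finally show False using odd by simp
  qed
  then show ?thesis using assms sub unfolding kochen_specker_def by blast
qed

section \<open>Equality of rays in the dual grid\<close>

locale odd_dual_grid =
  fixes p q :: nat and a b :: int
  assumes odd_p: "odd p" and p_ge: "p \<ge> 3" and odd_q: "odd q" and q_ge: "q \<ge> 3"
    and adm: "admissible p q a b"
begin

abbreviation "\<alpha> \<equiv> step_angle p a"
abbreviation "\<beta> \<equiv> step_angle q b"
abbreviation "c \<equiv> dual_c p q a b"
abbreviation "A \<equiv> rayA p q a b"
abbreviation "B \<equiv> rayB p q a b"
abbreviation "K \<equiv> grid_context p q a b"

text \<open>Equality of two points of the index torus, given by arbitrary integer
  representatives.\<close>

definition same_index :: "int \<Rightarrow> int \<Rightarrow> int \<Rightarrow> int \<Rightarrow> bool" where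
  "same_index i j k l \<longleftrightarrow> [i = k] (mod int p) \<and> [j = l] (mod int q)"

lemma c_squared: "c\<^sup>2 = - cos (\<alpha> - \<beta>) / cos (\<alpha> + \<beta>)"
  using adm by (simp add: admissible_def dual_c_def dual_c_squared_def)

lemma c_pos: "c > 0" and c_squared_neq_1: "c\<^sup>2 \<noteq> 1"
  and c_squared_times_cos: "c\<^sup>2 * cos (\<alpha> + \<beta>) = - cos (\<alpha> - \<beta>)"
  using adm unfolding c_squared by (auto simp: admissible_def dual_c_def dual_c_squared_def)

text \<open>The hypotheses are those delivered by \<open>ray_pair_eqD\<close>. They reduce to sin x
  cos y = cos x sin y and sin x sin y = 0; one sine vanishes, its cosine then does not, so the other
  sine vanishes too.\<close>

lemma same_index_of_angles:
  assumes "sin ((of_int i * \<alpha> - of_int j * \<beta>) - (of_int k * \<alpha> - of_int l * \<beta>)) = 0"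
    and "cos ((of_int i * \<alpha> - of_int j * \<beta>) - (of_int k * \<alpha> - of_int l * \<beta>)) =
         cos ((of_int i * \<alpha> + of_int j * \<beta>) - (of_int k * \<alpha> + of_int l * \<beta>))"
  shows "same_index i j k l"
proof -
  define x y where "x = of_int (i - k) * \<alpha>" and "y = of_int (j - l) * \<beta>"
  have "(of_int i * \<alpha> - of_int j * \<beta>) - (of_int k * \<alpha> - of_int l * \<beta>) = x - y"
    "(of_int i * \<alpha> + of_int j * \<beta>) - (of_int k * \<alpha> + of_int l * \<beta>) = x + y"
    by (simp_all add: x_def y_def algebra_simps)
  with assms have "sin (x - y) = 0" "cos (x - y) = cos (x + y)" by simp_all
  then have "sin x * sin y = 0" "sin x * cos y = cos x * sin y"
    by (simp_all add: sin_diff cos_diff cos_add)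
  then have "sin x = 0 \<and> sin y = 0"
    using sin_cos_squared_add[of x] sin_cos_squared_add[of y]
    by (metis add_0 mult_eq_0_iff zero_neq_one zero_power2)
  moreover have "coprime a (int p)" "coprime b (int q)"
    using adm by (simp_all add: admissible_def)
  ultimately show ?thesis
    using odd_p odd_q
    by (simp add: x_def y_def sin_step_angle_eq_0_iff same_index_def cong_iff_dvd_diff
        del: of_int_diff)
qed

lemma A_eq_iff: "A i j = A k l \<longleftrightarrow> same_index i j k l"
proof
  assume "A i j = A k l"
  then have "ray (1 *\<^sub>R unit_vec (of_int i * \<alpha> - of_int j * \<beta>), (- c) *\<^sub>R unit_vec (of_int i * \<alpha> + of_int j * \<beta>)) =
    ray (1 *\<^sub>R unit_vec (of_int k * \<alpha> - of_int l * \<beta>), (- c) *\<^sub>R unit_vec (of_int k * \<alpha> + of_int l * \<beta>))"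
    by (simp add: rayA_def)
  from ray_pair_eqD[OF this] show "same_index i j k l"
    using c_pos by (intro same_index_of_angles) auto
next
  assume "same_index i j k l"
  then show "A i j = A k l"
    using p_ge q_ge by (intro rayA_cong) (simp_all add: same_index_def)
qed

lemma B_eq_iff: "B i j = B k l \<longleftrightarrow> same_index i j k l"
proof
  assume "B i j = B k l"
  then have "ray (c *\<^sub>R unit_vec (of_int i * \<alpha> - of_int j * \<beta>), 1 *\<^sub>R unit_vec (of_int i * \<alpha> + of_int j * \<beta>)) =
    ray (c *\<^sub>R unit_vec (of_int k * \<alpha> - of_int l * \<beta>), 1 *\<^sub>R unit_vec (of_int k * \<alpha> + of_int l * \<beta>))"
    by (simp add: rayB_def)
  from ray_pair_eqD[OF this] show "same_index i j k l"
    using c_pos by (intro same_index_of_angles) auto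
next
  assume "same_index i j k l"
  then show "B i j = B k l"
    using p_ge q_ge by (intro rayB_cong) (simp_all add: same_index_def)
qed

text \<open>A proportionality factor t would satisfy \<open>t\<^sup>2 * c\<^sup>2 = 1\<close> by the
  first components and \<open>t\<^sup>2 = c\<^sup>2\<close> by the second. Hence the nonnegative
  number \<open>c\<^sup>2\<close> would be 1, which admissibility forbids.\<close>

lemma A_neq_B: "A i j \<noteq> B k l"
proof
  define \<theta> \<phi> \<theta>' \<phi>' where angles: "\<theta> = of_int i * \<alpha> - of_int j * \<beta>" "\<phi> = of_int i * \<alpha> + of_int j * \<beta>"
    "\<theta>' = of_int k * \<alpha> - of_int l * \<beta>" "\<phi>' = of_int k * \<alpha> + of_int l * \<beta>"
  assume "A i j = B k l"
  then have "ray (unit_vec \<theta>, (- c) *\<^sub>R unit_vec \<phi>) = ray (c *\<^sub>R unit_vec \<theta>', unit_vec \<phi>')"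
    by (simp add: rayA_def rayB_def angles)
  from ray_eqD[OF this] obtain t
    where "(unit_vec \<theta>, (- c) *\<^sub>R unit_vec \<phi>) = t *\<^sub>R (c *\<^sub>R unit_vec \<theta>', unit_vec \<phi>')" .
  then have t: "unit_vec \<theta> = (t * c) *\<^sub>R unit_vec \<theta>'" "(- c) *\<^sub>R unit_vec \<phi> = t *\<^sub>R unit_vec \<phi>'"
    by simp_all
  have "t\<^sup>2 * c\<^sup>2 = 1" using unit_vec_scaled(3)[OF t(1)] by (simp add: power_mult_distrib)
  moreover have "c\<^sup>2 = t\<^sup>2"
    using arg_cong[OF t(2), of "\<lambda>v. v \<bullet> v"] by (simp add: unit_vec_inner power2_eq_square)
  ultimately have "(c\<^sup>2)\<^sup>2 = 1" by (simp add: power2_eq_square)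
  then show False
    using c_squared_neq_1 zero_le_power2[of c] unfolding power2_eq_1_iff[of "c\<^sup>2"] by linarith
qed

section \<open>Incidence of rays and contexts\<close>

lemma A_in_K_iff: "A i j \<in> K k l \<longleftrightarrow> same_index i j k l \<or> same_index (i + 1) (j + 1) k l"
  \<comment> \<open>Adding 1 to both sides turns congruences to k - 1 and l - 1 into congruences to
    k and l.\<close>
  using cong_add_rcancel[of i 1 "k - 1" "int p"] cong_add_rcancel[of j 1 "l - 1" "int q"]
  by (auto simp: grid_context_def A_neq_B A_eq_iff same_index_def)

lemma B_in_K_iff: "B i j \<in> K k l \<longleftrightarrow> same_index i (j + 1) k l \<or> same_index (i + 1) j k l"
  using cong_add_rcancel[of i 1 "k - 1" "int p"] cong_add_rcancel[of j 1 "l - 1" "int q"]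
  by (auto simp: grid_context_def A_neq_B[symmetric] B_eq_iff same_index_def)

lemma same_index_sym: "same_index i j k l \<longleftrightarrow> same_index k l i j"
  by (auto simp: same_index_def cong_sym_eq)

lemma same_index_trans: "same_index i j k l \<Longrightarrow> same_index k l m n \<Longrightarrow> same_index i j m n"
  by (auto simp: same_index_def intro: cong_trans)

text \<open>Both moduli are at least 3, so neither divides a nonzero integer of absolute value at
  most 2. All later distinctness claims within a context and between contexts rest on this.\<close>

lemma same_index_offset:
  assumes "\<bar>d\<bar> \<le> 2" "\<bar>e\<bar> \<le> 2"
  shows "same_index i j (i + d) (j + e) \<longleftrightarrow> d = 0 \<and> e = 0"
proof -
  have "int m dvd d \<longleftrightarrow> d = 0" if "m \<ge> 3" "\<bar>d\<bar> \<le> 2" for m :: nat and d :: int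
    using that zdvd_not_zless[of "\<bar>d\<bar>" "int m"] by auto
  from this[OF p_ge assms(1)] this[OF q_ge assms(2)] show ?thesis
    by (simp add: same_index_def cong_iff_dvd_diff)
qed

lemma K_cong: "same_index i j k l \<Longrightarrow> K i j = K k l"
proof -
  assume "same_index i j k l"
  then have "A i j = A k l" "A (i - 1) (j - 1) = A (k - 1) (l - 1)"
    "B i (j - 1) = B k (l - 1)" "B (i - 1) j = B (k - 1) l"
    unfolding A_eq_iff B_eq_iff by (auto simp: same_index_def intro: cong_diff)
  then show "K i j = K k l"
    by (simp add: grid_context_def)
qed

text \<open>The two A rays of a context determine its index: if they were matched crosswise, (k, l)
  would be both (i + 1, j + 1) and (i - 1, j - 1) on the torus, a shift by 2 that is impossible for
  moduli at least 3.\<close>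

lemma K_eq_iff: "K i j = K k l \<longleftrightarrow> same_index i j k l"
proof
  assume eq: "K i j = K k l"
  have "A i j \<in> K i j" "A (i - 1) (j - 1) \<in> K i j"
    by (auto simp: grid_context_def)
  then have "same_index i j k l \<or> same_index (i + 1) (j + 1) k l"
    "same_index (i - 1) (j - 1) k l \<or> same_index i j k l"
    unfolding eq A_in_K_iff by simp_all
  moreover have "\<not> same_index (i - 1) (j - 1) (i + 1) (j + 1)"
    using same_index_offset[of 2 2 "i - 1" "j - 1"] by (simp add: add.commute)
  ultimately show "same_index i j k l"
    using same_index_sym same_index_trans by blast
qed (rule K_cong)

section \<open>Counting rays and contexts\<close>

lemma same_index_reduce:
  obtains k l where "(k, l) \<in> grid_indices p q" "same_index i j k l"
proof
  show "(i mod int p, j mod int q) \<in> grid_indices p q"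
    using p_ge q_ge by (simp add: grid_indices_def)
  show "same_index i j (i mod int p) (j mod int q)"
    by (simp add: same_index_def)
qed

lemma same_index_grid_indices:
  "(i, j) \<in> grid_indices p q \<Longrightarrow> (k, l) \<in> grid_indices p q \<Longrightarrow>
    same_index i j k l \<longleftrightarrow> i = k \<and> j = l"
  by (auto simp: grid_indices_def same_index_def cong_def)

text \<open>Shared by A, B and the contexts. The description as a \<open>range\<close> lets later
  proofs use all integer indices without reducing them.\<close>

lemma card_grid_image:
  assumes "\<And>i j k l. f i j = f k l \<longleftrightarrow> same_index i j k l"
  shows "{f i j | i j. (i, j) \<in> grid_indices p q} = range (\<lambda>(i, j). f i j)"
    and "finite {f i j | i j. (i, j) \<in> grid_indices p q}"
    and "card {f i j | i j. (i, j) \<in> grid_indices p q} = p * q"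
proof -
  have im: "{f i j | i j. (i, j) \<in> grid_indices p q} = (\<lambda>(i, j). f i j) ` grid_indices p q"
    by auto
  show "{f i j | i j. (i, j) \<in> grid_indices p q} = range (\<lambda>(i, j). f i j)"
  proof -
    have "f i j \<in> {f i j | i j. (i, j) \<in> grid_indices p q}" for i j
      using same_index_reduce[of i j] assms by fastforce
    then show ?thesis by auto
  qed
  show "finite {f i j | i j. (i, j) \<in> grid_indices p q}"
    unfolding im by (simp add: grid_indices_def)
  have "inj_on (\<lambda>(i, j). f i j) (grid_indices p q)"
    by (auto simp: inj_on_def assms same_index_grid_indices)
  then show "card {f i j | i j. (i, j) \<in> grid_indices p q} = p * q"
    unfolding im by (simp add: card_image) (simp add: grid_indices_def)
qed

lemmas setA_facts = card_grid_image[OF A_eq_iff, folded setA_def]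
lemmas setB_facts = card_grid_image[OF B_eq_iff, folded setB_def]
lemmas grid_contexts_facts = card_grid_image[OF K_eq_iff, folded grid_contexts_def]

lemma setA_setB_disjoint: "setA p q a b \<inter> setB p q a b = {}"
  using A_neq_B unfolding setA_facts(1) setB_facts(1) by fastforce

lemma card_dual_grid: "card (dual_grid p q a b) = 2 * p * q"
  unfolding dual_grid_def
  using card_Un_disjoint[OF setA_facts(2) setB_facts(2) setA_setB_disjoint]
  by (simp add: setA_facts(3) setB_facts(3))

lemma A_in_dual_grid: "A i j \<in> dual_grid p q a b"
  and B_in_dual_grid: "B i j \<in> dual_grid p q a b"
  unfolding dual_grid_def setA_facts(1) setB_facts(1) by auto

lemma A_in_rays: "A i j \<in> rays" and B_in_rays: "B i j \<in> rays"
  using unit_vec_nonzero by (auto simp: rayA_def rayB_def rays_def zero_prod_def)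

lemma dual_grid_subset_rays: "dual_grid p q a b \<subseteq> rays"
  unfolding dual_grid_def setA_facts(1) setB_facts(1) using A_in_rays B_in_rays by auto

section \<open>Orthogonality within contexts\<close>

lemma orthogonal_A_B:
  assumes "i = k \<or> j = l"
  shows "orthogonal_rays (A i j) (B k l)"
proof -
  define x y where "x = (of_int i * \<alpha> - of_int j * \<beta>) - (of_int k * \<alpha> - of_int l * \<beta>)"
    and "y = (of_int i * \<alpha> + of_int j * \<beta>) - (of_int k * \<alpha> + of_int l * \<beta>)"
  \<comment> \<open>The inner product is c (cos x - cos y), and sharing an index makes x and y agree
    up to sign.\<close>
  have "x = y \<or> x = - y"
    using assms by (auto simp: x_def y_def)
  then have "cos x = cos y" by auto
  then show ?thesis
    by (simp add: rayA_def rayB_def unit_vec_inner x_def y_def)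
qed

text \<open>The inner product is \<open>cos (\<alpha> - \<beta>) + c\<^sup>2 * cos (\<alpha> +
  \<beta>)\<close>, which the choice of c makes zero.\<close>

lemma orthogonal_A_A: "orthogonal_rays (A i j) (A (i - 1) (j - 1))"
proof -
  have "of_int i * \<alpha> - of_int j * \<beta> - (of_int (i - 1) * \<alpha> - of_int (j - 1) * \<beta>) = \<alpha> - \<beta>"
    "of_int i * \<alpha> + of_int j * \<beta> - (of_int (i - 1) * \<alpha> + of_int (j - 1) * \<beta>) = \<alpha> + \<beta>"
    by (simp_all add: algebra_simps)
  then show ?thesis
    using c_squared_times_cos
    by (simp add: rayA_def unit_vec_inner power2_eq_square mult.assoc del: of_int_diff)
qed

text \<open>Here the indices move in opposite directions, which swaps \<alpha> - \<beta> and
  \<alpha> + \<beta>; the coefficient c has also changed component, so the same sum results.\<close>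

lemma orthogonal_B_B: "orthogonal_rays (B i (j - 1)) (B (i - 1) j)"
proof -
  have "of_int i * \<alpha> - of_int (j - 1) * \<beta> - (of_int (i - 1) * \<alpha> - of_int j * \<beta>) = \<alpha> + \<beta>"
    "of_int i * \<alpha> + of_int (j - 1) * \<beta> - (of_int (i - 1) * \<alpha> + of_int j * \<beta>) = \<alpha> - \<beta>"
    by (simp_all add: algebra_simps)
  then show ?thesis
    using c_squared_times_cos
    by (simp add: rayB_def unit_vec_inner power2_eq_square mult.assoc del: of_int_diff)
qed

lemma orthogonal_context_K: "orthogonal_context (K i j)"
proof -
  have "A i j \<noteq> A (i - 1) (j - 1)" "B i (j - 1) \<noteq> B (i - 1) j"
    using same_index_offset[of "-1" "-1" i j] same_index_offset[of "-1" 1 i "j - 1"]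
    by (simp_all add: A_eq_iff B_eq_iff)
  then have "card (K i j) = 4"
    using A_neq_B by (simp add: grid_context_def)
  \<comment> \<open>Besides the AA and BB pairs there are four mixed pairs, each sharing one
    index.\<close>
  moreover have "pairwise orthogonal_rays (K i j)"
    unfolding grid_context_def pairwise_insert
    using orthogonal_A_A[of i j] orthogonal_B_B[of i j] orthogonal_A_B[of i i j "j - 1"]
      orthogonal_A_B[of i "i - 1" j j] orthogonal_A_B[of "i - 1" i "j - 1" "j - 1"]
      orthogonal_A_B[of "i - 1" "i - 1" "j - 1" j] orthogonal_rays_sym
    by simp blast
  moreover have "K i j \<subseteq> rays"
    using A_in_rays B_in_rays by (simp add: grid_context_def)
  ultimately show ?thesis by (simp add: orthogonal_context_def)
qed

section \<open>Contexts through a ray and the parity proof\<close>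

lemma contexts_orthogonal:
  "\<forall>C\<in>grid_contexts p q a b. orthogonal_context C \<and> C \<subseteq> dual_grid p q a b"
  unfolding grid_contexts_facts(1)
  using orthogonal_context_K A_in_dual_grid B_in_dual_grid by (auto simp: grid_context_def)

lemma card_contexts_A: "card {C \<in> grid_contexts p q a b. A i j \<in> C} = 2"
proof -
  \<comment> \<open>Reading \<open>K_eq_iff\<close> backwards turns index congruences into
    equalities of contexts, so the contexts through the ray form an explicit pair.\<close>
  have "{C \<in> grid_contexts p q a b. A i j \<in> C} = {K i j, K (i + 1) (j + 1)}"
    unfolding grid_contexts_facts(1) by (auto simp: A_in_K_iff K_eq_iff[symmetric])
  moreover have "K i j \<noteq> K (i + 1) (j + 1)"
    using same_index_offset[of 1 1 i j] by (simp add: K_eq_iff)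
  ultimately show ?thesis by simp
qed

lemma card_contexts_B: "card {C \<in> grid_contexts p q a b. B i j \<in> C} = 2"
proof -
  have "{C \<in> grid_contexts p q a b. B i j \<in> C} = {K i (j + 1), K (i + 1) j}"
    unfolding grid_contexts_facts(1) by (auto simp: B_in_K_iff K_eq_iff[symmetric])
  moreover have "K i (j + 1) \<noteq> K (i + 1) j"
    using same_index_offset[of 1 "-1" i "j + 1"] by (simp add: K_eq_iff)
  ultimately show ?thesis by simp
qed

lemma card_contexts_of_ray:
  "\<forall>r\<in>dual_grid p q a b. card {C \<in> grid_contexts p q a b. r \<in> C} = 2"
  unfolding dual_grid_def setA_facts(1) setB_facts(1)
  using card_contexts_A card_contexts_B by auto

text \<open>The number pq of contexts is odd as a product of odd numbers, and every ray count is
  2.\<close>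

lemma parity_proof_dual_grid: "parity_proof (dual_grid p q a b) (grid_contexts p q a b)"
  using contexts_orthogonal card_contexts_of_ray odd_p odd_q
  by (simp add: parity_proof_def grid_contexts_facts(3))

lemma kochen_specker_dual_grid: "kochen_specker (dual_grid p q a b) (grid_contexts p q a b)"
  using parity_proof_imp_kochen_specker[OF _ dual_grid_subset_rays parity_proof_dual_grid]
    setA_facts(2) setB_facts(2) by (simp add: dual_grid_def)

end

theorem theorem3p7:
  fixes p q :: nat
  assumes "odd p" and "p \<ge> 3" and "odd q" and "q \<ge> 3"
  shows "\<exists>a b :: int. admissible p q a b \<and>
    dual_grid p q a b \<subseteq> rays \<and>
    setA p q a b \<inter> setB p q a b = {} \<and>
    card (dual_grid p q a b) = 2 * p * q \<and>
    card (grid_contexts p q a b) = p * q \<and>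
    (\<forall>C\<in>grid_contexts p q a b. orthogonal_context C \<and> C \<subseteq> dual_grid p q a b) \<and>
    (\<forall>r\<in>dual_grid p q a b. card {C \<in> grid_contexts p q a b. r \<in> C} = 2) \<and>
    kochen_specker (dual_grid p q a b) (grid_contexts p q a b) \<and>
    parity_proof (dual_grid p q a b) (grid_contexts p q a b)"
proof -
  obtain a b where adm: "admissible p q a b"
    using admissible_exists assms by blast
  interpret odd_dual_grid p q a b
    using assms adm by unfold_locales
  show ?thesis
    using adm dual_grid_subset_rays setA_setB_disjoint card_dual_grid grid_contexts_facts(3)
      contexts_orthogonal card_contexts_of_ray kochen_specker_dual_grid parity_proof_dual_grid
    by blast
qed

end
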